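(* Let $t\geq 1$ and $m\geq 0$ be integers, and let $H_t^{t+m}$ be the signed graph obtained from an unbalanced $4$-cycle $C_4^-$ with vertices $a,b,c,d$ (in cyclic order), a path $P_t$ and a path $P_{t+m}$ (vertex-disjoint from each other and from the cycle), by joining an end vertex of $P_t$ to $a$ and an end vertex of $P_{t+m}$ to the opposite vertex $c$ (all path and joining edges positive). Then the spectrum of $H_t^{t+m}$ (as a multiset) consists of $$2\cos\frac{(2i-1)\pi}{2k},\quad i=1,\ldots,k,\ \text{where } k=t+m+2,$$ together with $$2\cos\frac{(2i-1)\pi}{2t+4},\quad i=1,\ldots,t+2.$$
   Context: A signed graph is a simple graph whose edges are each labelled positive or negative; its adjacency matrix is the usual adjacency matrix with entry $-1$ in place of $1$ for negative edges, and its spectrum is the spectrum of this matrix. A cycle is unbalanced if it contains an odd number of negative edges; $C_4^-$ denotes a $4$-cycle with an odd number of negative edges (e.g. exactly one). Switching (negating all edges between a vertex set $X$ and its complement) does not change the spectrum, so the choice of signs on $C_4^-$ is immaterial. *)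

theory Defs
  imports
    "Jordan_Normal_Form.Char_Poly"
    "HOL-Computational_Algebra.Polynomial"
    Complex_Main
begin

record sgraph =
  nverts :: nat
  edges :: "nat set set"
  negative :: "nat set set"

text \<open>The vertices of a signed graph of order \<open>n\<close> are \<open>0, \<dots>, n - 1\<close>; the positive edges are
  those in \<open>edges G - negative G\<close>.\<close>

definition signed_graph :: "sgraph \<Rightarrow> bool" where
  "signed_graph G \<longleftrightarrow>
     (\<forall>e \<in> edges G. \<exists>u v. u < nverts G \<and> v < nverts G \<and> u \<noteq> v \<and> e = {u, v}) \<and>
     negative G \<subseteq> edges G"

definition adjacency_matrix :: "sgraph \<Rightarrow> real mat" where
  "adjacency_matrix G = mat (nverts G) (nverts G)
     (\<lambda>(i, j). if {i, j} \<in> edges G then (if {i, j} \<in> negative G then - 1 else 1) else 0)"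

text \<open>Eigenvalues with their multiplicities. The matrix is real symmetric, so no eigenvalue is
  lost by taking the roots over the reals.\<close>

definition signed_spectrum :: "sgraph \<Rightarrow> real multiset" where
  "signed_spectrum G = proots (char_poly (adjacency_matrix G))"

text \<open>The path on the \<open>l\<close> vertices \<open>s, s + 1, \<dots>, s + l - 1\<close>.\<close>

definition path_edges :: "nat \<Rightarrow> nat \<Rightarrow> nat set set" where
  "path_edges s l = {{s + i, s + i + 1} | i. i + 1 < l}"

definition C4_edges :: "nat set set" where
  "C4_edges = {{0, 1}, {1, 2}, {2, 3}, {3, 0}}"

definition unbalanced :: "nat set set \<Rightarrow> nat set set \<Rightarrow> bool" where
  "unbalanced C N \<longleftrightarrow> odd (card (C \<inter> N))"

text \<open>\<open>H_graph t m N\<close> is \<open>H_t^{t+m}\<close> with \<open>N\<close> the set of negative edges of its 4-cycle. The cycle has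
  \<open>a, b, c, d = 0, 1, 2, 3\<close>; the path \<open>P_t\<close> has vertices \<open>4, \<dots>, t + 3\<close> with end \<open>4\<close> joined to \<open>a\<close>;
  the path \<open>P_{t+m}\<close> has vertices \<open>t + 4, \<dots>, 2 t + m + 3\<close> with end \<open>t + 4\<close> joined to \<open>c\<close>.\<close>

definition H_graph :: "nat \<Rightarrow> nat \<Rightarrow> nat set set \<Rightarrow> sgraph" where
  "H_graph t m N =
     \<lparr> nverts = 4 + t + (t + m),
       edges = C4_edges \<union> path_edges 4 t \<union> path_edges (4 + t) (t + m) \<union> {{0, 4}, {2, 4 + t}},
       negative = N \<rparr>"

lemma signed_graph_H_graph:
  assumes "t \<ge> 1" and "N \<subseteq> C4_edges"
  shows "signed_graph (H_graph t m N)"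
proof -
  have C4: "\<exists>u v. u < 4 + t + (t + m) \<and> v < 4 + t + (t + m) \<and> u \<noteq> v \<and> e = {u, v}"
    if eC: "e \<in> C4_edges" for e
  proof -
    have "\<exists>u v. u < 4 \<and> v < 4 \<and> u \<noteq> v \<and> e = {u, v}"
    proof -
      consider "e = {0, 1}" | "e = {1, 2}" | "e = {2, 3}" | "e = {3, 0}"
        using eC unfolding C4_edges_def by blast
      then show ?thesis
      proof cases
        case 1 then show ?thesis by (intro exI[of _ 0] exI[of _ 1]) simp
      next
        case 2 then show ?thesis by (intro exI[of _ 1] exI[of _ 2]) simp
      next
        case 3 then show ?thesis by (intro exI[of _ 2] exI[of _ 3]) simp
      next
        case 4 then show ?thesis by (intro exI[of _ 3] exI[of _ 0]) simp
      qed
    qed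
    then obtain u v where "u < 4" "v < 4" "u \<noteq> v" "e = {u, v}"
      by blast
    then show ?thesis by (intro exI[of _ u] exI[of _ v]) simp
  qed
  have path: "\<exists>u v. u < n \<and> v < n \<and> u \<noteq> v \<and> e = {u, v}"
    if e: "e \<in> path_edges s l" and n: "s + l \<le> n" for e s l n
  proof -
    obtain i where "i + 1 < l" "e = {s + i, s + i + 1}"
      using e unfolding path_edges_def by blast
    then show ?thesis
      using n by (intro exI[of _ "s + i"] exI[of _ "s + i + 1"]) simp
  qed
  have join: "\<exists>u v. u < 4 + t + (t + m) \<and> v < 4 + t + (t + m) \<and> u \<noteq> v \<and> e = {u, v}"
    if "e \<in> {{0, 4}, {2, 4 + t}}" for e
  proof (cases "e = {0, 4}")
    case True
    then show ?thesis using assms(1) by (intro exI[of _ 0] exI[of _ 4]) simp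
  next
    case False
    then have "e = {2, 4 + t}" using that by blast
    then show ?thesis using assms(1) by (intro exI[of _ 2] exI[of _ "4 + t"]) simp
  qed
  have "\<exists>u v. u < 4 + t + (t + m) \<and> v < 4 + t + (t + m) \<and> u \<noteq> v \<and> e = {u, v}"
    if "e \<in> C4_edges \<union> path_edges 4 t \<union> path_edges (4 + t) (t + m) \<union> {{0, 4}, {2, 4 + t}}" for e
    using that C4[of e] path[of e 4 t "4 + t + (t + m)"]
      path[of e "4 + t" "t + m" "4 + t + (t + m)"] join[of e] by (elim UnE) simp_all
  then show ?thesis
    using assms(2) unfolding signed_graph_def H_graph_def by auto
qed

end

theory Submission
  imports Defs
begin

text \<open>Since the cycle is unbalanced, the neighbourhood vectors of \<open>a\<close> and \<open>c\<close> in the span of \<open>b\<close> and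
  \<open>d\<close> are orthogonal. Taking them as new coordinates in place of \<open>b\<close> and \<open>d\<close> splits the adjacency
  matrix into two tridiagonal blocks of sizes \<open>t + 2\<close> and \<open>t + m + 2\<close>, each a path whose first
  off-diagonal entry is doubled. Such a block of size \<open>n\<close> has the eigenvectors
  \<open>(cos (j \<theta>))\<^sub>j\<close> with \<open>cos (n \<theta>) = 0\<close>, belonging to the \<open>n\<close> distinct eigenvalues \<open>2 cos \<theta>\<close>.\<close>

section \<open>Characteristic polynomials, root multisets and tridiagonal row sums\<close>

lemma char_poly_four_block_diag:
  fixes A D :: "'a :: idom mat"
  assumes A: "A \<in> carrier_mat n n" and D: "D \<in> carrier_mat m m"
  shows "char_poly (four_block_mat A (0\<^sub>m n m) (0\<^sub>m m n) D) = char_poly A * char_poly D"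
proof -
  have "char_poly_matrix (four_block_mat A (0\<^sub>m n m) (0\<^sub>m m n) D) =
      four_block_mat (char_poly_matrix A) (0\<^sub>m n m) (0\<^sub>m m n) (char_poly_matrix D)"
    using A D by (intro eq_matI) (auto simp: char_poly_matrix_def one_poly_def)
  then show ?thesis
    unfolding char_poly_def using A D
    by (simp add: det_four_block_mat_upper_right_zero[of _ n _ m])
qed

text \<open>Counted with multiplicity there are at most \<open>degree p\<close> roots, so that many
  distinct zeros exhaust them and are all simple. A spectrum can thus be read off from exhibited
  eigenvalues, without computing the polynomial.\<close>

lemma proots_eq_mset_set:
  fixes p :: "'a :: idom poly"
  assumes "p \<noteq> 0" "finite S" "\<And>x. x \<in> S \<Longrightarrow> poly p x = 0" "card S = degree p"
  shows "proots p = mset_set S"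
proof -
  have sub: "mset_set S \<subseteq># proots p"
  proof (rule mset_subset_eqI)
    fix a
    show "count (mset_set S) a \<le> count (proots p) a"
      using assms order_root[of p a] by (cases "a \<in> S") (auto simp: Suc_le_eq)
  qed
  moreover have "size (proots p) \<le> size (mset_set S)"
    using size_proots_le[of p] assms(4) by simp
  ultimately show ?thesis
    by (metis mset_subset_size subset_mset.le_imp_less_or_eq not_less)
qed

lemma sum_two_neighbours:
  fixes f :: "nat \<Rightarrow> 'a :: semiring_1"
  assumes "i < n"
  shows "(\<Sum>l = 0..<n. (if l = Suc i then a else if i = Suc l then b else 0) * f l) =
    (if Suc i < n then a * f (Suc i) else 0) + (if 0 < i then b * f (i - 1) else 0)"
proof -
  have "(\<Sum>l = 0..<n. (if l = Suc i then a else if i = Suc l then b else 0) * f l) =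
      (\<Sum>l = 0..<n. (if l = Suc i then a * f l else 0) + (if l = i - 1 then (if 0 < i then b * f l else 0) else 0))"
    by (intro sum.cong) auto
  also have "\<dots> = (if Suc i < n then a * f (Suc i) else 0) + (if 0 < i then b * f (i - 1) else 0)"
    using assms by (auto simp: sum.distrib sum.delta)
  finally show ?thesis .
qed

section \<open>The spectrum of the folded path\<close>

text \<open>For \<open>n \<ge> 2\<close> this is the quotient matrix of the path on
  \<open>2 * n - 1\<close> vertices under reflection at its middle vertex, which has two neighbours
  in the next orbit; hence the \<open>2\<close> in row \<open>0\<close> only.\<close>

definition folded_path_matrix :: "nat \<Rightarrow> real mat" where
  "folded_path_matrix n = mat n n
     (\<lambda>(i, j). if j = Suc i then (if i = 0 then 2 else 1) else if i = Suc j then 1 else 0)"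

lemma folded_path_matrix_carrier [simp]: "folded_path_matrix n \<in> carrier_mat n n"
  by (simp add: folded_path_matrix_def)

text \<open>Inner rows are the identity \<open>cos ((i + 1) \<theta>) + cos ((i - 1) \<theta>) = 2
  cos \<theta> cos (i \<theta>)\<close>. In row \<open>0\<close> the two cosines coincide because
  cosine is even, which matches the entry \<open>2\<close>.\<close>

lemma eigenvalue_folded_path_matrix:
  assumes "n > 0" and "cos (real n * \<theta>) = 0"
  shows "eigenvalue (folded_path_matrix n) (2 * cos \<theta>)"
proof -
  define v where "v = vec n (\<lambda>j. cos (real j * \<theta>))"
  have "v $ 0 \<noteq> 0\<^sub>v n $ 0"
    using assms(1) by (simp add: v_def)
  then have "v \<noteq> 0\<^sub>v n"
    by auto
  moreover have "folded_path_matrix n *\<^sub>v v = (2 * cos \<theta>) \<cdot>\<^sub>v v"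
  proof (rule eq_vecI)
    fix i assume "i < dim_vec ((2 * cos \<theta>) \<cdot>\<^sub>v v)"
    then have i: "i < n" by (simp add: v_def)
    have "(folded_path_matrix n *\<^sub>v v) $ i =
        (\<Sum>l = 0..<n. (if l = Suc i then (if i = 0 then 2 else 1) else if i = Suc l then 1 else 0)
           * cos (real l * \<theta>))"
      using i by (simp add: folded_path_matrix_def v_def scalar_prod_def)
    also have "\<dots> = (if Suc i < n then (if i = 0 then 2 else 1) * cos (real (Suc i) * \<theta>) else 0)
        + (if 0 < i then 1 * cos (real (i - 1) * \<theta>) else 0)"
      by (rule sum_two_neighbours[OF i])
    also have "\<dots> = (if i = 0 then 2 else 1) * cos (real (Suc i) * \<theta>)
        + (if 0 < i then cos (real (i - 1) * \<theta>) else 0)"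
    proof (cases "Suc i < n")
      case False
      then have "Suc i = n" using i by simp
      then have "cos (real (Suc i) * \<theta>) = 0" using assms(2) by simp
      then show ?thesis using False by simp
    qed simp
    also have "\<dots> = 2 * cos \<theta> * cos (real i * \<theta>)"
    proof (cases i)
      case (Suc j)
      have "cos (real (Suc i) * \<theta>) = cos (real i * \<theta> + \<theta>)"
        "cos (real j * \<theta>) = cos (real i * \<theta> - \<theta>)"
        by (simp_all add: Suc algebra_simps)
      then have "cos (real (Suc i) * \<theta>) + cos (real j * \<theta>) = 2 * cos \<theta> * cos (real i * \<theta>)"
        by (simp only: cos_add cos_diff) (simp add: algebra_simps)
      then show ?thesis by (simp add: Suc)
    qed simp
    finally show "(folded_path_matrix n *\<^sub>v v) $ i = ((2 * cos \<theta>) \<cdot>\<^sub>v v) $ i"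
      using i by (simp add: v_def)
  qed (simp add: v_def folded_path_matrix_def)
  ultimately have "eigenvector (folded_path_matrix n) v (2 * cos \<theta>)"
    by (simp add: eigenvector_def v_def folded_path_matrix_def)
  then show ?thesis
    unfolding eigenvalue_def by blast
qed

text \<open>The \<open>n\<close> angles are distinct and lie in the interval from \<open>0\<close>
  to \<open>pi\<close>, where cosine is injective, so they give \<open>n\<close> distinct roots of a
  monic polynomial of degree \<open>n\<close>.\<close>

lemma proots_char_poly_folded_path_matrix:
  "proots (char_poly (folded_path_matrix n)) =
     {# 2 * cos ((2 * real i - 1) * pi / (2 * real n)). i \<in># mset_set {1..n} #}"
proof -
  define ev where "ev = (\<lambda>i. 2 * cos ((2 * real i - 1) * pi / (2 * real n)))"
  have inj: "inj_on ev {1..n}"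
  proof (rule inj_onI)
    fix i j assume i: "i \<in> {1..n}" and j: "j \<in> {1..n}" and eq: "ev i = ev j"
    have bound: "0 \<le> (2 * real l - 1) * pi / (2 * real n) \<and> (2 * real l - 1) * pi / (2 * real n) \<le> pi"
      if "l \<in> {1..n}" for l
    proof -
      have "0 \<le> 2 * real l - 1" "2 * real l - 1 \<le> 2 * real n" "0 < real n"
        using that by auto
      then show ?thesis
        by (simp add: divide_le_eq mult.commute mult_left_mono)
    qed
    have "(2 * real i - 1) * pi / (2 * real n) = (2 * real j - 1) * pi / (2 * real n)"
      by (rule cos_inj_pi) (use eq bound[OF i] bound[OF j] in \<open>simp_all only: ev_def mult_cancel_left, simp_all\<close>)
    then show "i = j"
      using i by auto
  qed
  have root: "poly (char_poly (folded_path_matrix n)) (ev i) = 0" if i: "i \<in> {1..n}" for i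
  proof -
    \<comment> \<open>An odd multiple of \<open>pi / 2\<close>, in the integer form that
      \<open>cos_zero_iff_int\<close> expects.\<close>
    have angle: "real n * ((2 * real i - 1) * pi / (2 * real n)) = of_int (2 * int i - 1) * (pi / 2)"
      using i by simp
    have "cos (of_int (2 * int i - 1) * (pi / 2)) = 0"
      unfolding cos_zero_iff_int by (intro exI[of _ "2 * int i - 1"]) simp
    then have "cos (real n * ((2 * real i - 1) * pi / (2 * real n))) = 0"
      unfolding angle .
    then have "eigenvalue (folded_path_matrix n) (ev i)"
      unfolding ev_def using i by (intro eigenvalue_folded_path_matrix) auto
    then show ?thesis
      by (simp add: eigenvalue_root_char_poly[of _ n])
  qed
  have deg: "degree (char_poly (folded_path_matrix n)) = n"
    and "coeff (char_poly (folded_path_matrix n)) n = 1"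
    using degree_monic_char_poly[OF folded_path_matrix_carrier[of n]] by auto
  then have "char_poly (folded_path_matrix n) \<noteq> 0"
    by auto
  then have "proots (char_poly (folded_path_matrix n)) = mset_set (ev ` {1..n})"
    using root deg card_image[OF inj] by (intro proots_eq_mset_set) auto
  also have "\<dots> = image_mset ev (mset_set {1..n})"
    using inj by (rule image_mset_mset_set[symmetric])
  finally show ?thesis
    by (simp add: ev_def)
qed

section \<open>Signs on the 4-cycle and entries of the adjacency matrix\<close>

definition edge_sign :: "nat set set \<Rightarrow> nat set \<Rightarrow> real" where
  "edge_sign N e = (if e \<in> N then - 1 else 1)"

lemma edge_sign_mult_self [simp]: "edge_sign N e * edge_sign N e = 1"
  by (simp add: edge_sign_def)

lemma prod_edge_sign:
  assumes "finite C"
  shows "(\<Prod>e\<in>C. edge_sign N e) = (- 1) ^ card (C \<inter> N)"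
  using assms by (simp add: edge_sign_def prod.If_cases Int_def)

text \<open>The four signs multiply to \<open>- 1\<close>, so the products along the two routes from
  \<open>a\<close> to \<open>c\<close>, through \<open>b\<close> and through \<open>d\<close>, are
  opposite. Their sum is the inner product of the neighbourhood vectors of \<open>a\<close> and
  \<open>c\<close> on \<open>b\<close> and \<open>d\<close>.\<close>

lemma unbalanced_C4_orthogonal:
  assumes "unbalanced C4_edges N"
  shows "edge_sign N {0, 1} * edge_sign N {1, 2} + edge_sign N {3, 0} * edge_sign N {2, 3} = 0"
proof -
  have "(\<Prod>e\<in>C4_edges. edge_sign N e) = - 1"
    using assms prod_edge_sign[of C4_edges N] by (simp add: unbalanced_def C4_edges_def)
  moreover have "(\<Prod>e\<in>C4_edges. edge_sign N e) =
      edge_sign N {0, 1} * edge_sign N {1, 2} * edge_sign N {2, 3} * edge_sign N {3, 0}"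
    by (simp add: C4_edges_def doubleton_eq_iff mult.assoc)
  ultimately show ?thesis
    by (simp add: edge_sign_def split: if_splits)
qed

lemma in_path_edges_iff:
  "{u, v} \<in> path_edges s l \<longleftrightarrow>
     s \<le> u \<and> v = Suc u \<and> v < s + l \<or> s \<le> v \<and> u = Suc v \<and> u < s + l"
proof
  assume "{u, v} \<in> path_edges s l"
  then show "s \<le> u \<and> v = Suc u \<and> v < s + l \<or> s \<le> v \<and> u = Suc v \<and> u < s + l"
    by (auto simp: path_edges_def doubleton_eq_iff)
next
  assume "s \<le> u \<and> v = Suc u \<and> v < s + l \<or> s \<le> v \<and> u = Suc v \<and> u < s + l"
  then show "{u, v} \<in> path_edges s l"
  proof
    assume "s \<le> u \<and> v = Suc u \<and> v < s + l"
    then show ?thesis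
      unfolding path_edges_def by (intro CollectI exI[of _ "u - s"]) auto
  next
    assume "s \<le> v \<and> u = Suc v \<and> u < s + l"
    then show ?thesis
      unfolding path_edges_def by (intro CollectI exI[of _ "v - s"]) auto
  qed
qed

text \<open>Only cycle edges can be negative, so every other nonzero entry is \<open>1\<close>. In
  the last branch the exclusions at \<open>4\<close> and \<open>4 + t\<close> remove pairs that are
  consecutive as numbers but not adjacent: \<open>3\<close> and \<open>4\<close>, and the end of
  \<open>P_t\<close> with the start of \<open>P_{t+m}\<close>.\<close>

lemma adjacency_matrix_H_graph_index:
  assumes "t \<ge> 1" "N \<subseteq> C4_edges" "u < 4 + t + (t + m)" "v < 4 + t + (t + m)"
  shows "adjacency_matrix (H_graph t m N) $$ (u, v) =
    (if u = 0 then (if v = 1 then edge_sign N {0, 1} else if v = 3 then edge_sign N {3, 0}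
        else if v = 4 then 1 else 0)
     else if u = 1 then (if v = 0 then edge_sign N {0, 1} else if v = 2 then edge_sign N {1, 2} else 0)
     else if u = 2 then (if v = 1 then edge_sign N {1, 2} else if v = 3 then edge_sign N {2, 3}
        else if v = 4 + t then 1 else 0)
     else if u = 3 then (if v = 0 then edge_sign N {3, 0} else if v = 2 then edge_sign N {2, 3} else 0)
     else if v = Suc u \<and> v \<noteq> 4 + t \<or> u = Suc v \<and> u \<noteq> 4 \<and> u \<noteq> 4 + t \<or> u = 4 \<and> v = 0 \<or> u = 4 + t \<and> v = 2
        then 1 else 0)"
proof -
  have N: "e \<in> C4_edges" if "e \<in> N" for e
    using assms(2) that by blast
  have entry: "adjacency_matrix (H_graph t m N) $$ (u, v) =
      (if {u, v} \<in> edges (H_graph t m N) then edge_sign N {u, v} else 0)"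
    using assms by (simp add: adjacency_matrix_def edge_sign_def H_graph_def)
  have sign: "edge_sign N {u, v} = 1" if "u \<ge> 4 \<or> v \<ge> 4"
    using that N[of "{u, v}"] by (auto simp: edge_sign_def C4_edges_def doubleton_eq_iff)
  have edge: "{u, v} \<in> edges (H_graph t m N) \<longleftrightarrow> {u, v} \<in> C4_edges \<or> {u, v} \<in> path_edges 4 t
      \<or> {u, v} \<in> path_edges (4 + t) (t + m) \<or> {u, v} = {0, 4} \<or> {u, v} = {2, 4 + t}"
    by (simp add: H_graph_def disj_ac del: insert_eq_iff doubleton_eq_iff)
  have comm: "edge_sign N {0, 3} = edge_sign N {3, 0}" "edge_sign N {1, 0} = edge_sign N {0, 1}"
    "edge_sign N {2, 1} = edge_sign N {1, 2}" "edge_sign N {3, 2} = edge_sign N {2, 3}"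
    by (simp_all add: insert_commute)
  show ?thesis
  proof (cases "u \<ge> 4")
    case u: True
    then have sgn: "edge_sign N {u, v} = 1" using sign by simp
    have small: "(u = 0) = False" "(u = 1) = False" "(u = 2) = False" "(u = 3) = False"
      using u by simp_all
    have C4: "{u, v} \<notin> C4_edges" using u by (simp add: C4_edges_def doubleton_eq_iff)
    show ?thesis
    proof (cases "v \<ge> 4")
      case v: True
      have edge': "{u, v} \<in> edges (H_graph t m N) \<longleftrightarrow> v = Suc u \<and> v \<noteq> 4 + t \<or> u = Suc v \<and> u \<noteq> 4 + t"
      proof -
        have "{u, v} \<noteq> {0, 4}" "{u, v} \<noteq> {2, 4 + t}"
          using u v by (simp_all add: doubleton_eq_iff)
        then have paths: "{u, v} \<in> edges (H_graph t m N) \<longleftrightarrow>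
            {u, v} \<in> path_edges 4 t \<or> {u, v} \<in> path_edges (4 + t) (t + m)"
          using C4 edge by simp
        consider "v = Suc u" | "u = Suc v" | "v \<noteq> Suc u" "u \<noteq> Suc v" by blast
        then show ?thesis
          unfolding paths in_path_edges_iff using u v assms(3,4) by cases auto
      qed
      show ?thesis
        unfolding entry edge' sgn small if_False using u v
        by (intro if_cong refl) linarith
    next
      case False
      then have "v \<in> {0, 1, 2, 3}" by auto
      moreover have edge': "{u, v} \<in> edges (H_graph t m N) \<longleftrightarrow> u = 4 \<and> v = 0 \<or> u = 4 + t \<and> v = 2"
        using u False C4 unfolding edge in_path_edges_iff doubleton_eq_iff by auto
      ultimately show ?thesis
        unfolding entry edge' sgn small if_False using u assms(1)
        by (elim insertE emptyE) simp_all
    qed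
  next
    case False
    then have u: "u = 0 \<or> u = 1 \<or> u = 2 \<or> u = 3" by linarith
    show ?thesis
    proof (cases "v \<ge> 4")
      case True
      then have sgn: "edge_sign N {u, v} = 1" using sign by simp
      have edge': "{u, v} \<in> edges (H_graph t m N) \<longleftrightarrow> v = 4 \<and> u = 0 \<or> v = 4 + t \<and> u = 2"
        using u True unfolding edge in_path_edges_iff C4_edges_def doubleton_eq_iff
        by (auto simp: doubleton_eq_iff)
      show ?thesis
        unfolding entry edge' sgn using u True by (elim disjE) simp_all
    next
      case v: False
      have edge': "{u, v} \<in> edges (H_graph t m N) \<longleftrightarrow> {u, v} \<in> C4_edges"
        using False v unfolding edge in_path_edges_iff doubleton_eq_iff by linarith
      have "v = 0 \<or> v = 1 \<or> v = 2 \<or> v = 3" using v by linarith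
      with u show ?thesis
        unfolding entry edge' C4_edges_def insert_iff empty_iff doubleton_eq_iff
        by (elim disjE) (simp_all add: comm[simplified])
    qed
  qed
qed

section \<open>The change of coordinates and the block splitting\<close>

text \<open>\<open>split_coord t N i l\<close> is the coefficient of the vertex \<open>l\<close> in the \<open>i\<close>-th new coordinate. The
  coordinates \<open>0, \<dots>, t + 1\<close> are the neighbourhood vector of \<open>a\<close>, then \<open>a\<close>, then \<open>P_t\<close>; the remaining
  ones are the neighbourhood vector of \<open>c\<close>, then \<open>c\<close>, then \<open>P_{t+m}\<close>.\<close>

definition split_vertex :: "nat \<Rightarrow> nat \<Rightarrow> nat" where
  "split_vertex t i = (if i = 1 then 0 else if i < t + 2 then i + 2 else if i = t + 3 then 2 else i)"

definition split_coord :: "nat \<Rightarrow> nat set set \<Rightarrow> nat \<Rightarrow> nat \<Rightarrow> real" where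
  "split_coord t N i l =
     (if i = 0 then (if l = 1 then edge_sign N {0, 1} else if l = 3 then edge_sign N {3, 0} else 0)
      else if i = t + 2 then (if l = 1 then edge_sign N {1, 2} else if l = 3 then edge_sign N {2, 3} else 0)
      else if l = split_vertex t i then 1 else 0)"

lemma sum_split_coord:
  assumes "t \<ge> 1" "i < 4 + t + (t + m)"
  shows "(\<Sum>l = 0..<4 + t + (t + m). split_coord t N i l * f l) =
    (if i = 0 then edge_sign N {0, 1} * f 1 + edge_sign N {3, 0} * f 3
     else if i = t + 2 then edge_sign N {1, 2} * f 1 + edge_sign N {2, 3} * f 3
     else f (split_vertex t i))"
proof -
  have two: "(\<Sum>l = 0..<4 + t + (t + m). (if l = 1 then x else if l = 3 then y else 0) * f l) =
      x * f 1 + y * f 3" for x y :: real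
  proof -
    have "(\<Sum>l = 0..<4 + t + (t + m). (if l = 1 then x else if l = 3 then y else 0) * f l) =
        (\<Sum>l = 0..<4 + t + (t + m). (if l = 1 then x * f l else 0) + (if l = 3 then y * f l else 0))"
      by (intro sum.cong) auto
    also have "\<dots> = x * f 1 + y * f 3"
      by (simp add: sum.distrib)
    finally show ?thesis .
  qed
  have one: "(\<Sum>l = 0..<4 + t + (t + m). (if l = v then 1 else 0) * f l) = f v"
    if "v < 4 + t + (t + m)" for v
  proof -
    have "(\<Sum>l = 0..<4 + t + (t + m). (if l = v then 1 else 0) * f l) =
        (\<Sum>l = 0..<4 + t + (t + m). if l = v then f l else 0)"
      by (intro sum.cong) auto
    then show ?thesis
      using that by simp
  qed
  have "split_vertex t i < 4 + t + (t + m)"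
    using assms by (simp add: split_vertex_def)
  then show ?thesis
    unfolding split_coord_def using two one by simp
qed

text \<open>Written as a single matrix, the block sum still has rows of the shape treated by
  \<open>sum_two_neighbours\<close>: the link between \<open>q - 1\<close> and \<open>q\<close> is
  cut, and row \<open>q\<close> starts a second doubled path.\<close>

lemma four_block_folded_path_matrix:
  "four_block_mat (folded_path_matrix q) (0\<^sub>m q k) (0\<^sub>m k q) (folded_path_matrix k) = mat (q + k) (q + k)
     (\<lambda>(i, j). if j = Suc i then (if Suc i = q then 0 else if i = 0 \<or> i = q then 2 else 1)
       else if i = Suc j then (if i = q then 0 else 1) else 0)"
  (is "?L = ?R")
proof (rule eq_matI)
  fix i j assume "i < dim_row ?R" "j < dim_col ?R"
  then have ij: "i < q + k" "j < q + k" by simp_all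
  consider "i < q" "j < q" | "i < q" "q \<le> j" | "q \<le> i" "j < q"
    | i' j' where "i = q + i'" "j = q + j'"
    by (meson le_iff_add not_less)
  then show "?L $$ (i, j) = ?R $$ (i, j)"
    using ij by cases (simp_all add: folded_path_matrix_def)
qed (simp_all add: folded_path_matrix_def)

text \<open>The rows of \<open>R\<close> are the new coordinates. The core is the intertwining
  relation \<open>R * A = D * R\<close>, which says that \<open>A\<close> acts on these coordinates
  as the two folded paths.\<close>

lemma similar_adjacency_matrix_H_graph:
  assumes t: "t \<ge> 1" and N: "N \<subseteq> C4_edges" and unb: "unbalanced C4_edges N"
  shows "similar_mat (adjacency_matrix (H_graph t m N))
    (four_block_mat (folded_path_matrix (t + 2)) (0\<^sub>m (t + 2) (t + m + 2))
       (0\<^sub>m (t + m + 2) (t + 2)) (folded_path_matrix (t + m + 2)))"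
proof -
  define n where "n = 4 + t + (t + m)"
  define A where "A = adjacency_matrix (H_graph t m N)"
  define D where "D = four_block_mat (folded_path_matrix (t + 2)) (0\<^sub>m (t + 2) (t + m + 2))
    (0\<^sub>m (t + m + 2) (t + 2)) (folded_path_matrix (t + m + 2))"
  define R where "R = mat n n (\<lambda>(i, l). split_coord t N i l)"
  \<comment> \<open>The rows of \<open>R\<close> are pairwise orthogonal, with squared norm
    \<open>2\<close> for the two neighbourhood vectors and \<open>1\<close> otherwise; the inverse
    is therefore the transpose with those two columns halved.\<close>
  define S where "S = mat n n (\<lambda>(l, i). split_coord t N i l / (if i = 0 \<or> i = t + 2 then 2 else 1))"
  have A: "A \<in> carrier_mat n n"
    by (simp add: A_def adjacency_matrix_def H_graph_def n_def)
  have "D \<in> carrier_mat (t + 2 + (t + m + 2)) (t + 2 + (t + m + 2))"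
    unfolding D_def by (intro four_block_carrier_mat) simp_all
  moreover have "t + 2 + (t + m + 2) = n" by (simp add: n_def)
  ultimately have D: "D \<in> carrier_mat n n" by simp
  have R: "R \<in> carrier_mat n n" and S: "S \<in> carrier_mat n n"
    by (simp_all add: R_def S_def)
  have orth: "edge_sign N {0, 1} * edge_sign N {1, 2} + edge_sign N {3, 0} * edge_sign N {2, 3} = 0"
    by (rule unbalanced_C4_orthogonal[OF unb])
  then have orth': "edge_sign N {1, 2} * edge_sign N {0, 1} + edge_sign N {2, 3} * edge_sign N {3, 0} = 0"
    by (simp add: mult.commute)
  have RM: "(R * M) $$ (i, j) =
      (if i = 0 then edge_sign N {0, 1} * M $$ (1, j) + edge_sign N {3, 0} * M $$ (3, j)
       else if i = t + 2 then edge_sign N {1, 2} * M $$ (1, j) + edge_sign N {2, 3} * M $$ (3, j)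
       else M $$ (split_vertex t i, j))"
    if M: "M \<in> carrier_mat n n" and ij: "i < n" "j < n" for M i j
  proof -
    have "(R * M) $$ (i, j) = (\<Sum>l = 0..<n. split_coord t N i l * M $$ (l, j))"
      using M ij by (simp add: R_def scalar_prod_def)
    then show ?thesis
      using sum_split_coord[OF t ij(1)[unfolded n_def], of N "\<lambda>l. M $$ (l, j)"] by (simp add: n_def)
  qed
  have vtx: "split_vertex t i < n" "split_vertex t i \<noteq> 1" "split_vertex t i \<noteq> 3"
    if "i < n" "i \<noteq> 0" "i \<noteq> t + 2" for i
    using that t by (auto simp: split_vertex_def n_def)
  \<comment> \<open>Indices \<open>0\<close> and \<open>t + 2\<close> stand for neighbourhood
    vectors, not vertices; the default value at \<open>0\<close> would collide with that at
    \<open>t + 3\<close>.\<close>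
  have vtx_inj: "split_vertex t i = split_vertex t j \<longleftrightarrow> i = j"
    if "i \<noteq> 0" "i \<noteq> t + 2" "j \<noteq> 0" "j \<noteq> t + 2" for i j
    using that t by (auto simp: split_vertex_def split: if_splits)
  have n: "1 < n" "3 < n" by (simp_all add: n_def)
  have RS: "R * S = 1\<^sub>m n"
  proof (rule eq_matI)
    fix i j assume "i < dim_row (1\<^sub>m n :: real mat)" "j < dim_col (1\<^sub>m n :: real mat)"
    then have ij: "i < n" "j < n" by simp_all
    show "(R * S) $$ (i, j) = 1\<^sub>m n $$ (i, j)"
    proof (cases "i = 0 \<or> i = t + 2")
      case i: True
      show ?thesis
      proof (cases "j = 0 \<or> j = t + 2")
        case True
        with i consider "i = 0" "j = 0" | "i = 0" "j = t + 2" | "i = t + 2" "j = 0"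
          | "i = t + 2" "j = t + 2" by blast
        then show ?thesis
          unfolding RM[OF S ij] using ij n orth orth'
          by cases (simp_all add: S_def split_coord_def add_divide_distrib[symmetric])
      next
        case False
        then have "split_vertex t j \<noteq> 1" "split_vertex t j \<noteq> 3" "i \<noteq> j"
          using vtx[of j] ij i by auto
        then show ?thesis
          unfolding RM[OF S ij] using i ij n False by (auto simp: S_def split_coord_def)
      qed
    next
      case False
      then show ?thesis
        unfolding RM[OF S ij] using ij vtx[of i] vtx_inj[of i j]
        by (simp add: S_def split_coord_def)
    qed
  qed (simp_all add: R_def S_def)
  then have SR: "S * R = 1\<^sub>m n"
    by (rule mat_mult_left_right_inverse[OF R S])
  have RA: "R * A = D * R"
  proof (rule eq_matI)
    fix i j assume "i < dim_row (D * R)" "j < dim_col (D * R)"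
    then have ij: "i < n" "j < n" using D R by simp_all
    let ?r = "\<lambda>i. split_coord t N i j"
    have "(D * R) $$ (i, j) = (\<Sum>l = 0..<n. (if l = Suc i
          then (if Suc i = t + 2 then 0 else if i = 0 \<or> i = t + 2 then 2 else 1)
          else if i = Suc l then (if i = t + 2 then 0 else 1) else 0) * ?r l)"
      using ij unfolding D_def four_block_folded_path_matrix
      by (simp add: R_def scalar_prod_def n_def)
    then have DR: "(D * R) $$ (i, j) =
        (if Suc i < n then (if Suc i = t + 2 then 0 else if i = 0 \<or> i = t + 2 then 2 else 1) * ?r (Suc i) else 0)
        + (if 0 < i then (if i = t + 2 then 0 else 1) * ?r (i - 1) else 0)"
      unfolding sum_two_neighbours[OF ij(1)] .
    have Aij: "A $$ (u, j) = 
    (if u = 0 then (if j = 1 then edge_sign N {0, 1} else if j = 3 then edge_sign N {3, 0}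
        else if j = 4 then 1 else 0)
     else if u = 1 then (if j = 0 then edge_sign N {0, 1} else if j = 2 then edge_sign N {1, 2} else 0)
     else if u = 2 then (if j = 1 then edge_sign N {1, 2} else if j = 3 then edge_sign N {2, 3}
        else if j = 4 + t then 1 else 0)
     else if u = 3 then (if j = 0 then edge_sign N {3, 0} else if j = 2 then edge_sign N {2, 3} else 0)
     else if j = Suc u \<and> j \<noteq> 4 + t \<or> u = Suc j \<and> u \<noteq> 4 \<and> u \<noteq> 4 + t \<or> u = 4 \<and> j = 0 \<or> u = 4 + t \<and> j = 2
        then 1 else 0)"
      if "u < n" for u
      unfolding A_def using adjacency_matrix_H_graph_index[OF t N] that ij(2) by (simp add: n_def)
    \<comment> \<open>Here \<open>p\<close> is the neighbour of the path vertex \<open>u\<close> on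
      the side of the cycle: \<open>a\<close> or \<open>c\<close> for the first vertex of a path,
      and \<open>u - 1\<close> for later ones.\<close>
    have Apath: "A $$ (u, j) = (if j = p \<or> j = Suc u \<and> j \<noteq> 4 + t then 1 else 0)"
      if "u < n" "4 \<le> u" "u = 4 \<and> p = 0 \<or> u = 4 + t \<and> p = 2 \<or> u \<noteq> 4 \<and> u \<noteq> 4 + t \<and> u = Suc p" for u p
    proof -
      have small: "(u = 0) = False" "(u = 1) = False" "(u = 2) = False" "(u = 3) = False"
        using that(2) by simp_all
      show ?thesis
        unfolding Aij[OF that(1)] small if_False using that t by (intro if_cong refl) linarith
    qed
    \<comment> \<open>In order: the neighbourhood vector of \<open>a\<close>, \<open>a\<close>, the
      first vertex of \<open>P_t\<close>, the rest of \<open>P_t\<close>, then the same four stages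
      for \<open>c\<close> and \<open>P_{t+m}\<close>.\<close>
    consider "i = 0" | "i = 1" | "i = 2" | "3 \<le> i" "i < t + 2" | "i = t + 2" | "i = t + 3"
      | "i = t + 4" | "t + 5 \<le> i"
      by linarith
    then show "(R * A) $$ (i, j) = (D * R) $$ (i, j)"
    proof cases
      case 1
      \<comment> \<open>The coefficient of \<open>a\<close> is a sum of two squared signs, hence the
        \<open>2\<close> in the block; the coefficient of \<open>c\<close> vanishes by
        \<open>orth\<close>.\<close>
      then show ?thesis
        unfolding RM[OF A ij] DR Aij[OF n(1)] Aij[OF n(2)] using n t orth
        by (simp add: split_coord_def split_vertex_def)
    next
      case 2
      then have row: "(R * A) $$ (i, j) = A $$ (0, j)"
        unfolding RM[OF A ij] using t by (simp add: split_vertex_def)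
      then show ?thesis
        unfolding DR using 2 n t by (simp add: Aij split_coord_def split_vertex_def)
    next
      case 3
      then have row: "(R * A) $$ (i, j) = A $$ (4, j)"
        unfolding RM[OF A ij] using t by (simp add: split_vertex_def)
      have u: "4 < n" "Suc i < n" using 3 t by (simp_all add: n_def)
      \<comment> \<open>For \<open>t = 1\<close> vertex \<open>4\<close> already ends
        \<open>P_t\<close>: vertex \<open>5\<close> belongs to the other path, and the next
        coordinate opens the second block.\<close>
      have "A $$ (4, j) = (if j = 0 then 1 else if j = 5 \<and> t \<noteq> 1 then 1 else 0)"
        using Apath[OF u(1), of 0] t by simp
      moreover have "?r (i - 1) = (if j = 0 then 1 else 0)"
        using 3 t by (simp add: split_coord_def split_vertex_def)
      moreover have "?r (Suc i) = (if j = 5 then 1 else 0)" if "t \<noteq> 1"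
        using 3 t that by (simp add: split_coord_def split_vertex_def)
      ultimately show ?thesis
        unfolding DR row using 3 t u(2) by (cases "t = 1") simp_all
    next
      case 4
      then have row: "(R * A) $$ (i, j) = A $$ (i + 2, j)"
        unfolding RM[OF A ij] by (simp add: split_vertex_def)
      have u: "i + 2 < n" "Suc i < n" using 4 by (simp_all add: n_def)
      \<comment> \<open>\<open>Suc i = t + 2\<close> marks the last vertex of \<open>P_t\<close>,
        whose numerical successor starts the other path.\<close>
      have "A $$ (i + 2, j) = (if j = i + 1 then 1 else if j = i + 3 \<and> Suc i \<noteq> t + 2 then 1 else 0)"
        using Apath[OF u(1), of "i + 1"] 4 by simp
      moreover have "?r (i - 1) = (if j = i + 1 then 1 else 0)"
        using 4 by (simp add: split_coord_def split_vertex_def) linarith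
      moreover have "?r (Suc i) = (if j = i + 3 then 1 else 0)" if "Suc i \<noteq> t + 2"
        using 4 that by (simp add: split_coord_def split_vertex_def)
      ultimately show ?thesis
        unfolding DR row using 4 u(2) by (cases "Suc i = t + 2") simp_all
    next
      case 5
      then have "Suc i < n" using t by (simp add: n_def)
      with 5 show ?thesis
        unfolding RM[OF A ij] DR Aij[OF n(1)] Aij[OF n(2)] using t orth'
        by (simp add: split_coord_def split_vertex_def)
    next
      case 6
      then have row: "(R * A) $$ (i, j) = A $$ (2, j)"
        unfolding RM[OF A ij] using t by (simp add: split_vertex_def)
      have u: "2 < n" "Suc i < n" using 6 t by (simp_all add: n_def)
      show ?thesis
        unfolding DR row using 6 u t by (simp add: Aij split_coord_def split_vertex_def)
    next
      case 7
      then have row: "(R * A) $$ (i, j) = A $$ (t + 4, j)"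
        unfolding RM[OF A ij] by (simp add: split_vertex_def)
      have u: "t + 4 < n" using 7 ij by simp
      have "A $$ (t + 4, j) = (if j = 2 then 1 else if j = t + 5 then 1 else 0)"
        using Apath[OF u, of 2] t by simp
      moreover have "?r (i - 1) = (if j = 2 then 1 else 0)"
        using 7 by (simp add: split_coord_def split_vertex_def)
      moreover have "?r (Suc i) = (if j = t + 5 then 1 else 0)"
        using 7 by (simp add: split_coord_def split_vertex_def)
      ultimately show ?thesis
        unfolding DR row using 7 ij(2) by (cases "Suc i < n") simp_all
    next
      case 8
      then have row: "(R * A) $$ (i, j) = A $$ (i, j)"
        unfolding RM[OF A ij] by (simp add: split_vertex_def)
      have "A $$ (i, j) = (if j = i - 1 then 1 else if j = Suc i then 1 else 0)"
        using Apath[OF ij(1), of "i - 1"] 8 by simp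
      moreover have "?r (i - 1) = (if j = i - 1 then 1 else 0)"
        using 8 by (simp add: split_coord_def split_vertex_def) linarith
      moreover have "?r (Suc i) = (if j = Suc i then 1 else 0)"
        using 8 by (simp add: split_coord_def split_vertex_def)
      moreover have "i - 1 \<noteq> Suc i" by simp
      \<comment> \<open>At the last coordinate \<open>Suc i = n\<close> there is no next term on the
        right, and \<open>j < n\<close> rules out \<open>j = Suc i\<close> on the left.\<close>
      ultimately show ?thesis
        unfolding DR row using 8 ij(2) by (cases "Suc i < n") simp_all
    qed
  qed (use A D R in simp_all)
  have "A = S * R * A"
    using A SR by simp
  also have "\<dots> = S * D * R"
    using RA assoc_mult_mat[OF S R A] assoc_mult_mat[OF S D R] by simp
  finally have "A = S * D * R" .
  then have "similar_mat_wit A D S R"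
    using SR RS A D S R by (intro similar_mat_witI)
  then show ?thesis
    unfolding similar_mat_def A_def D_def by blast
qed

theorem theorem3p6:
  fixes t m k :: nat and N :: "nat set set"
  assumes "t \<ge> 1" and "m \<ge> 0"
    and "N \<subseteq> C4_edges" and "unbalanced C4_edges N"
    and "k = t + m + 2"
  shows "signed_spectrum (H_graph t m N) =
      {# 2 * cos ((2 * real i - 1) * pi / (2 * real k)). i \<in># mset_set {1..k} #} +
      {# 2 * cos ((2 * real i - 1) * pi / (2 * real t + 4)). i \<in># mset_set {1..t + 2} #}"
proof -
  \<comment> \<open>Nonzero factors are required for \<open>proots\<close> to turn the product into
    a multiset sum.\<close>
  have nz: "char_poly (folded_path_matrix n) \<noteq> 0" for n
    using degree_monic_char_poly[OF folded_path_matrix_carrier[of n]] by auto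
  have "char_poly (adjacency_matrix (H_graph t m N)) =
      char_poly (folded_path_matrix (t + 2)) * char_poly (folded_path_matrix k)"
    using char_poly_similar[OF similar_adjacency_matrix_H_graph[OF assms(1,3,4)]]
      char_poly_four_block_diag[of "folded_path_matrix (t + 2)" "t + 2" "folded_path_matrix k" k]
    by (simp add: assms(5))
  then have "signed_spectrum (H_graph t m N) =
      proots (char_poly (folded_path_matrix k)) + proots (char_poly (folded_path_matrix (t + 2)))"
    by (simp add: signed_spectrum_def proots_mult nz)
  moreover have "2 * real (t + 2) = 2 * real t + 4"
    by simp
  ultimately show ?thesis
    unfolding proots_char_poly_folded_path_matrix by presburger
qed

end
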